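(* Let $G=(V,E)$ be a finite simple undirected graph that is Eulerian, i.e. it has a closed trail traversing every edge exactly once, and run the one-pass streaming algorithm Euler-Tour (described in the context) on a stream of its edges. Then the written triples determine an Euler tour of $G$ in the following sense. The set $R^*(E)$ contains exactly one orientation of each edge of $E$, and $\delta^*$ is a well-defined map $R^*(E)\to R^*(E)$. Moreover, for every $e\in R^*(E)$, writing $x_{(1)}$ for the first node of a directed edge $x$, the node sequence $(e_{(1)},\delta^*(e)_{(1)},\ldots,(\delta^* )^{|E|}(e)_{(1)})$ is an Euler tour of the directed graph $(V,R^*(E))$. That is, the directed edges $e,\delta^*(e),\ldots,(\delta^* )^{|E|-1}(e)$ are pairwise distinct, they are exactly $R^*(E)$, and $(\delta^* )^{|E|}(e)=e$.
   Context: Setting: $G=(V,E)$ is a finite simple undirected graph with $n=|V|$. It is given as a stream of its edges, each read once in arbitrary order. RAM variables of Euler-Tour: - a counter $c$, initially $0$; - a set $F$ of directed edges, initially $\emptyset$; - a set $E_{\mathrm{int}}$ of undirected edges, initially $\emptyset$; - for each $v\in V$, values $j(v)\in V\cup\{0\}$ and $t(v)\in\mathbb{N}\cup\{0\}$, initially $0$. Output: triples $(v_1,v_2,s)$ of nodes with $\{v_1,v_2\}\in E$, meaning that the directed edge $(v_2,s)$ is marked as the successor of the directed edge $(v_1,v_2)$. Main loop: for each edge $e$ read from the stream, add $e$ to $E_{\mathrm{int}}$. If the graph $(V,E_{\mathrm{int}})$ now contains a cycle $C$, call Merge-Cycle$(C)$ with $C$ written as an ordered cycle $(v_1,\ldots,v_k)$.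 Indices are taken cyclically, so $v_0=v_k$ and $v_{k+1}=v_1$. The directed edges of $C$ are $(v_i,v_{i+1})$. Merge-Cycle performs the following steps in order. 1. For $i=1,\ldots,k$: if $t(v_i)=0$, set $j(v_i):=v_{i+1}$ and add $(v_{i-1},v_i)$ to $F$. 2. Set $M:=\emptyset$ and $J:=\emptyset$. For each $j=1,\ldots,|V|$: if some $v_i$ has $t(v_i)=j$, add exactly one such $v_i$ to $J$ and add $j$ to $M$. 3. For each $v_i\in J$: write $(v_{i-1},v_i,j(v_i))$, then set $j(v_i):=v_{i+1}$. 4. For each edge $(v_i,v_{i+1})$ of $C$ that has been neither written nor added to $F$: write $(v_i,v_{i+1},v_{i+2})$. 5. If $M=\emptyset$, set $c:=c+1$ and $a:=c$; otherwise set $a:=\min M$. For each $v\in V$ with $t(v)\in M$, set $t(v):=a$. For $i=1,\ldots,k$, set $t(v_i):=a$. 6. Delete the edges of $C$ from $E_{\mathrm{int}}$. After the stream ends: - If $E_{\mathrm{int}}\neq\emptyset$, an error "odd degree node" is reported. - If there are nodes with $t(u)\ne t(v)\ne 0$, an error "not connected" is reported. - Finally, for each $(u,v)\in F$, the triple $(u,v,j(v))$ is written. Definitions used in the claim: $R^*(E)$ is the set of directed edges $(u,v)$ for which some triple $(u,v,s)$ was written. $\delta^*$ is given by $\delta^*((v_1,v_2))=(v_2,s)$ for each written triple $(v_1,v_2,s)$. An Euler tour of a directed graph $(V,A)$ is a node sequence $(w_0,\ldots,w_m)$ with $w_0=w_m$ such that the directed edges $(w_{i-1},w_i)$, $i\in[m]$,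 are pairwise distinct, belong to $A$, and together are all of $A$. *)

theory Defs
  imports Main
begin

section \<open>Graphs and Euler tours\<close>

definition simple_graph :: "'a set \<Rightarrow> 'a set set \<Rightarrow> bool" where
  "simple_graph V E \<longleftrightarrow> finite V \<and> (\<forall>e\<in>E. e \<subseteq> V \<and> card e = 2)"

definition steps :: "'a list \<Rightarrow> ('a \<times> 'a) list" where
  "steps ws = zip ws (tl ws)"

definition undirected :: "'a \<times> 'a \<Rightarrow> 'a set" where
  "undirected x = {fst x, snd x}"

text \<open>
  Only the edges have to be covered by the closed trail, so isolated nodes are allowed.
\<close>

definition eulerian :: "'a set \<Rightarrow> 'a set set \<Rightarrow> bool" where
  "eulerian V E \<longleftrightarrow>
     (\<exists>ws. ws \<noteq> [] \<and> set ws \<subseteq> V \<and> hd ws = last ws \<and>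
           distinct (map undirected (steps ws)) \<and> set (map undirected (steps ws)) = E)"

definition euler_tour :: "'a set \<Rightarrow> ('a \<times> 'a) set \<Rightarrow> 'a list \<Rightarrow> bool" where
  "euler_tour V A ws \<longleftrightarrow>
     ws \<noteq> [] \<and> set ws \<subseteq> V \<and> hd ws = last ws \<and> distinct (steps ws) \<and> set (steps ws) = A"

text \<open>
  A cycle \<open>(v\<^sub>1, \<dots>, v\<^sub>k)\<close> is a list of length \<open>k\<close>; \<open>cyc vs i\<close> is \<open>v\<^sub>i\<close>, with
  indices counted from 1 and taken cyclically, so \<open>cyc vs 0 = v\<^sub>k\<close> and
  \<open>cyc vs (k + 1) = v\<^sub>1\<close>.
\<close>

definition cyc :: "'a list \<Rightarrow> nat \<Rightarrow> 'a" where
  "cyc vs i = vs ! ((i + length vs - 1) mod length vs)"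

definition is_cycle :: "'a set \<Rightarrow> 'a set set \<Rightarrow> 'a list \<Rightarrow> bool" where
  "is_cycle V E vs \<longleftrightarrow>
     3 \<le> length vs \<and> distinct vs \<and> set vs \<subseteq> V \<and>
     (\<forall>i\<in>{1..length vs}. {cyc vs i, cyc vs (i + 1)} \<in> E)"


section \<open>The algorithm\<close>

text \<open>
  The value 0 of \<open>j\<close> is rendered as \<open>None\<close>. The order in which triples are written is
  irrelevant, so the output is kept as the set of written triples.
\<close>

record 'a et_state =
  cnt :: nat
  Fset :: "('a \<times> 'a) set"
  Eint :: "'a set set"
  jval :: "'a \<Rightarrow> 'a option"
  tval :: "'a \<Rightarrow> nat"
  written :: "('a \<times> 'a \<times> 'a) set"

definition init_state :: "'a et_state" where
  "init_state =
     \<lparr>cnt = 0, Fset = {}, Eint = {}, jval = (\<lambda>_. None), tval = (\<lambda>_. 0), written = {}\<rparr>"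

text \<open>The loop ``for \<open>i = 1, \<dots>, k\<close>: if \<open>P v\<^sub>i\<close>, set \<open>j(v\<^sub>i) := v\<^sub>i\<^sub>+\<^sub>1\<close>''.\<close>

definition set_succs :: "'a list \<Rightarrow> ('a \<Rightarrow> bool) \<Rightarrow> ('a \<Rightarrow> 'a option) \<Rightarrow> 'a \<Rightarrow> 'a option" where
  "set_succs vs P j =
     fold (\<lambda>i j. if P (cyc vs i) then j(cyc vs i := Some (cyc vs (i + 1))) else j)
       [1..<length vs + 1] j"

definition cycle_classes :: "'a set \<Rightarrow> 'a list \<Rightarrow> ('a \<Rightarrow> nat) \<Rightarrow> nat set" where
  "cycle_classes V vs t = {m \<in> {1..card V}. \<exists>v\<in>set vs. t v = m}"

definition is_selection :: "'a set \<Rightarrow> 'a list \<Rightarrow> ('a \<Rightarrow> nat) \<Rightarrow> 'a set \<Rightarrow> bool" where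
  "is_selection V vs t J \<longleftrightarrow>
     J \<subseteq> {v \<in> set vs. t v \<in> cycle_classes V vs t} \<and>
     (\<forall>m \<in> cycle_classes V vs t. \<exists>!v. v \<in> J \<and> t v = m)"

text \<open>
  The nodes of a cycle are pairwise distinct, so the value \<open>j(v\<^sub>i)\<close> that is written for
  \<open>v\<^sub>i \<in> J\<close> is not affected by the updates of \<open>j\<close> at the other nodes of \<open>J\<close>: it is the value
  \<open>j1\<close> before the loop over \<open>J\<close>. Likewise the directed edges of the cycle are pairwise distinct,
  so \<open>W4\<close> may test against the triples written before that loop.
\<close>

definition merge_cycle :: "'a set \<Rightarrow> 'a list \<Rightarrow> 'a set \<Rightarrow> 'a et_state \<Rightarrow> 'a et_state" where
  "merge_cycle V vs J s =
    (let k = length vs; v = cyc vs; t = tval s;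
         j1 = set_succs vs (\<lambda>u. t u = 0) (jval s);
         F1 = Fset s \<union> {(v (i - 1), v i) | i. i \<in> {1..k} \<and> t (v i) = 0};
         M = cycle_classes V vs t;
         W3 = written s \<union> {(v (i - 1), v i, the (j1 (v i))) | i. i \<in> {1..k} \<and> v i \<in> J};
         j3 = set_succs vs (\<lambda>u. u \<in> J) j1;
         W4 = W3 \<union> {(v i, v (i + 1), v (i + 2)) | i. i \<in> {1..k} \<and>
                (\<forall>x. (v i, v (i + 1), x) \<notin> W3) \<and> (v i, v (i + 1)) \<notin> F1};
         c' = (if M = {} then cnt s + 1 else cnt s);
         a = (if M = {} then c' else Min M);
         t' = (\<lambda>u. if u \<in> set vs \<or> u \<in> V \<and> t u \<in> M then a else t u)
     in \<lparr>cnt = c', Fset = F1, Eint = Eint s - {{v i, v (i + 1)} | i. i \<in> {1..k}},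
         jval = j3, tval = t', written = W4\<rparr>)"

text \<open>
  The algorithm leaves open how the cycle is written as an ordered cycle and which nodes are
  selected for \<open>J\<close>; a run may make these choices arbitrarily.
\<close>

inductive read_edge :: "'a set \<Rightarrow> 'a set \<Rightarrow> 'a et_state \<Rightarrow> 'a et_state \<Rightarrow> bool"
  for V e s where
  no_cycle:
    "\<not> (\<exists>vs. is_cycle V (insert e (Eint s)) vs) \<Longrightarrow>
     read_edge V e s (s\<lparr>Eint := insert e (Eint s)\<rparr>)"
| cycle:
    "is_cycle V (insert e (Eint s)) vs \<Longrightarrow> is_selection V vs (tval s) J \<Longrightarrow>
     read_edge V e s (merge_cycle V vs J (s\<lparr>Eint := insert e (Eint s)\<rparr>))"

inductive read_stream :: "'a set \<Rightarrow> 'a set list \<Rightarrow> 'a et_state \<Rightarrow> 'a et_state \<Rightarrow> bool"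
  for V where
  Nil: "read_stream V [] s s"
| Cons: "read_edge V e s s' \<Longrightarrow> read_stream V es s' s'' \<Longrightarrow> read_stream V (e # es) s s''"

datatype et_error = Odd_Degree_Node | Not_Connected

definition final_errors :: "'a set \<Rightarrow> 'a et_state \<Rightarrow> et_error set" where
  "final_errors V s =
     (if Eint s \<noteq> {} then {Odd_Degree_Node} else {}) \<union>
     (if \<exists>u\<in>V. \<exists>v\<in>V. tval s u \<noteq> tval s v \<and> tval s v \<noteq> 0 then {Not_Connected} else {})"

definition final_written :: "'a et_state \<Rightarrow> ('a \<times> 'a \<times> 'a) set" where
  "final_written s = written s \<union> {(u, v, the (jval s v)) | u v. (u, v) \<in> Fset s}"

text \<open>
  \<open>W\<close> is the set of triples written and \<open>errs\<close> the set of errors reported by some run on the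
  stream \<open>es\<close>. Reporting an error does not suppress the final writing step.
\<close>

definition euler_tour_run ::
    "'a set \<Rightarrow> 'a set list \<Rightarrow> ('a \<times> 'a \<times> 'a) set \<Rightarrow> et_error set \<Rightarrow> bool" where
  "euler_tour_run V es W errs \<longleftrightarrow>
     (\<exists>s. read_stream V es init_state s \<and> W = final_written s \<and> errs = final_errors V s)"

text \<open>Runs exist for every stream, so quantifying over all runs is never vacuous.\<close>

lemma is_selection_exists: "\<exists>J. is_selection V vs t J"
proof -
  let ?M = "cycle_classes V vs t"
  define f where "f m = (SOME v. v \<in> set vs \<and> t v = m)" for m
  have f: "f m \<in> set vs \<and> t (f m) = m" if "m \<in> ?M" for m
  proof -
    from that have "\<exists>v. v \<in> set vs \<and> t v = m"
      by (auto simp: cycle_classes_def)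
    then show ?thesis
      unfolding f_def by (rule someI_ex)
  qed
  then have "is_selection V vs t (f ` ?M)"
    unfolding is_selection_def by (auto intro!: ex1I)
  then show ?thesis ..
qed

lemma euler_tour_run_exists: "\<exists>W errs. euler_tour_run V es W errs"
proof -
  have edge: "\<exists>s'. read_edge V e s s'" for e and s :: "'a et_state"
    using is_selection_exists by (metis read_edge.intros)
  have "\<exists>s'. read_stream V es s s'" for s :: "'a et_state"
    by (induction es arbitrary: s) (use edge in \<open>blast intro: read_stream.intros\<close>)+
  then show ?thesis
    unfolding euler_tour_run_def by blast
qed


section \<open>The directed edges and successors determined by the written triples\<close>

definition Rstar :: "('a \<times> 'a \<times> 'a) set \<Rightarrow> ('a \<times> 'a) set" where
  "Rstar W = {(u, v). \<exists>s. (u, v, s) \<in> W}"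

definition succ_rel :: "('a \<times> 'a \<times> 'a) set \<Rightarrow> (('a \<times> 'a) \<times> ('a \<times> 'a)) set" where
  "succ_rel W = {((u, v), (v, s)) | u v s. (u, v, s) \<in> W}"

definition well_defined_succ :: "('a \<times> 'a \<times> 'a) set \<Rightarrow> bool" where
  "well_defined_succ W \<longleftrightarrow> (\<forall>x \<in> Rstar W. (\<exists>!y. (x, y) \<in> succ_rel W) \<and>
     (\<forall>y. (x, y) \<in> succ_rel W \<longrightarrow> y \<in> Rstar W))"

definition dstar :: "('a \<times> 'a \<times> 'a) set \<Rightarrow> 'a \<times> 'a \<Rightarrow> 'a \<times> 'a" where
  "dstar W x = (THE y. (x, y) \<in> succ_rel W)"

definition one_orientation_each :: "'a set set \<Rightarrow> ('a \<times> 'a) set \<Rightarrow> bool" where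
  "one_orientation_each E R \<longleftrightarrow>
     (\<forall>x\<in>R. undirected x \<in> E) \<and> (\<forall>e\<in>E. \<exists>!x. x \<in> R \<and> undirected x = e)"

end

theory Submission
  imports Defs
begin

text \<open>
  Complete the written triples by \<open>(u, v, j v)\<close> for \<open>(u, v) \<in> F\<close>. At every moment the successor
  map given by these triples is a permutation of the directed edges seen in cycles so far, and
  edges whose target nodes have the same label lie on the same orbit. A new cycle is an orbit of
  its own; for each label on it, exchanging the successors of one cycle edge and of the unique
  edge of \<open>F\<close> entering the same node joins the two orbits. Orbits are handled through the sets
  closed under the successor map: two edges are on the same orbit iff no such set separates them.
  At the end \<open>E\<^sub>i\<^sub>n\<^sub>t\<close> is acyclic with even degrees, hence empty, and the Eulerian trail forces all
  labels on edges to agree, so that there is a single orbit.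
\<close>

section \<open>Successor maps that are permutations\<close>

text \<open>\<open>P\<close> may contain pairs outside \<open>Rstar W\<close>, so that one
  \<open>P\<close> can be tested against the successor maps before and after a merge.\<close>

definition closed_under :: "('a \<times> 'a \<times> 'a) set \<Rightarrow> ('a \<times> 'a) set \<Rightarrow> bool" where
  "closed_under W P \<longleftrightarrow> (\<forall>u v x. (u, v, x) \<in> W \<longrightarrow> (u, v) \<in> P \<longrightarrow> (v, x) \<in> P)"

lemma closed_underD: "closed_under W P \<Longrightarrow> (u, v, x) \<in> W \<Longrightarrow> (u, v) \<in> P \<Longrightarrow> (v, x) \<in> P"
  by (auto simp: closed_under_def)

lemma RstarI: "(u, v, x) \<in> W \<Longrightarrow> (u, v) \<in> Rstar W"
  by (auto simp: Rstar_def)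

lemma RstarE:
  assumes "(u, v) \<in> Rstar W"
  obtains x where "(u, v, x) \<in> W"
  using assms by (auto simp: Rstar_def)

text \<open>Stated on triples, so that a merge can be checked triple by triple. In
  \<open>injective\<close> a common middle node loses nothing, since the image \<open>(v, x)\<close>
  of an edge determines \<open>v\<close>.\<close>

locale successor_permutation =
  fixes W :: "('a \<times> 'a \<times> 'a) set"
  assumes finite_Rstar: "finite (Rstar W)"
    and functional: "(u, v, x) \<in> W \<Longrightarrow> (u, v, y) \<in> W \<Longrightarrow> x = y"
    and injective: "(u, v, x) \<in> W \<Longrightarrow> (w, v, x) \<in> W \<Longrightarrow> u = w"
    and into: "(u, v, x) \<in> W \<Longrightarrow> (v, x) \<in> Rstar W"
begin

lemma dstar_eq: "(u, v, x) \<in> W \<Longrightarrow> dstar W (u, v) = (v, x)"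
  unfolding dstar_def succ_rel_def by (rule the_equality) (auto dest: functional)

lemma dstar_triple:
  assumes "e \<in> Rstar W"
  shows "(fst e, snd e, snd (dstar W e)) \<in> W" "fst (dstar W e) = snd e"
proof -
  obtain x where x: "(fst e, snd e, x) \<in> W"
    using assms RstarE[of "fst e" "snd e"] by auto
  then show "(fst e, snd e, snd (dstar W e)) \<in> W" "fst (dstar W e) = snd e"
    using dstar_eq[OF x] by auto
qed

lemma dstar_in: "e \<in> Rstar W \<Longrightarrow> dstar W e \<in> Rstar W"
  using into[OF dstar_triple(1)] dstar_triple(2) by (metis prod.collapse)

lemma inj_on_dstar: "inj_on (dstar W) (Rstar W)"
proof (rule inj_onI)
  fix x y assume x: "x \<in> Rstar W" and y: "y \<in> Rstar W" and eq: "dstar W x = dstar W y"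
  have "snd x = snd y"
    using dstar_triple(2)[OF x] dstar_triple(2)[OF y] eq by simp
  moreover from this have "fst x = fst y"
    using dstar_triple(1)[OF x] dstar_triple(1)[OF y] eq injective by metis
  ultimately show "x = y"
    by (simp add: prod_eq_iff)
qed

lemma dstar_image: "dstar W ` Rstar W = Rstar W"
  using finite_Rstar inj_on_dstar dstar_in by (intro endo_inj_surj) auto

lemma well_defined_succ: "well_defined_succ W"
  unfolding well_defined_succ_def succ_rel_def
  by (auto dest: functional into elim!: RstarE)

text \<open>An injective self-map of the finite set \<open>P \<inter> Rstar W\<close> is onto, so
  \<open>(v, x)\<close> has a preimage in \<open>P\<close>, which injectivity identifies as
  \<open>(u, v)\<close>.\<close>

lemma closed_under_backward:
  assumes P: "closed_under W P" and W: "(u, v, x) \<in> W" and "(v, x) \<in> P"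
  shows "(u, v) \<in> P"
proof -
  let ?Q = "P \<inter> Rstar W"
  have "dstar W ` ?Q \<subseteq> ?Q"
    using dstar_in dstar_triple closed_underD[OF P dstar_triple(1)]
    by (metis (no_types, lifting) Int_iff image_subsetI prod.collapse)
  then have "dstar W ` ?Q = ?Q"
    using finite_Rstar inj_on_dstar by (intro endo_inj_surj) (auto intro: inj_on_subset)
  then obtain y where "y \<in> ?Q" "dstar W y = (v, x)"
    using assms into by (metis Int_iff imageE)
  then have "y = (u, v)"
    using dstar_eq[OF W] inj_on_dstar RstarI[OF W] by (metis Int_iff inj_onD)
  with \<open>y \<in> ?Q\<close> show ?thesis
    by simp
qed

text \<open>\<open>dstar W\<close> maps the edges entering \<open>v\<close> bijectively onto the
  edges leaving \<open>v\<close>.\<close>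

lemma balanced: "card {e \<in> Rstar W. fst e = v} = card {e \<in> Rstar W. snd e = v}"
proof -
  have "dstar W ` {e \<in> Rstar W. snd e = v} = {e \<in> Rstar W. fst e = v}"
  proof (intro equalityI subsetI)
    fix e assume e: "e \<in> {e \<in> Rstar W. fst e = v}"
    then obtain y where "y \<in> Rstar W" "e = dstar W y"
      using dstar_image by blast
    with e show "e \<in> dstar W ` {e \<in> Rstar W. snd e = v}"
      using dstar_triple(2) by auto
  qed (auto simp: dstar_in dstar_triple(2))
  then show ?thesis
    using card_image[of "dstar W" "{e \<in> Rstar W. snd e = v}"] inj_on_dstar
    by (metis (no_types, lifting) inj_on_subset mem_Collect_eq subsetI)
qed

section \<open>Iterates of the successor map\<close>

lemma funpow_dstar_in: "e \<in> Rstar W \<Longrightarrow> (dstar W ^^ i) e \<in> Rstar W"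
  by (induction i) (auto simp: dstar_in)

text \<open>Injectivity strips the common initial iterations, so a repetition anywhere in the orbit
  makes \<open>e\<close> itself periodic.\<close>

lemma funpow_dstar_cancel:
  assumes "e \<in> Rstar W" "(dstar W ^^ i) e = (dstar W ^^ (i + p)) e"
  shows "(dstar W ^^ p) e = e"
  using assms(2)
proof (induction i)
  case (Suc i)
  then have "(dstar W ^^ i) e = (dstar W ^^ (i + p)) e"
    using inj_on_dstar funpow_dstar_in[OF assms(1)] by (auto dest: inj_onD)
  then show ?case
    by (rule Suc.IH)
qed simp

text \<open>The orbit of \<open>e\<close> is closed under successors, so by \<open>conn\<close> it
  is all of \<open>Rstar W\<close>. The iterates before the first return to \<open>e\<close> are
  distinct and exhaust it, so the first return time is \<open>n\<close>.\<close>

lemma single_orbit: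
  assumes e: "e \<in> Rstar W" and conn: "\<And>P. closed_under W P \<Longrightarrow> e \<in> P \<Longrightarrow> Rstar W \<subseteq> P"
  defines "f \<equiv> (\<lambda>i. (dstar W ^^ i) e)" and "n \<equiv> card (Rstar W)"
  shows "f n = e" "inj_on f {..<n}" "f ` {..<n} = Rstar W"
proof -
  have range: "range f = Rstar W"
  proof
    have "closed_under W (range f)"
      unfolding closed_under_def
    proof (intro allI impI)
      fix u v x assume "(u, v, x) \<in> W" "(u, v) \<in> range f"
      then obtain i where "(u, v) = f i"
        by auto
      then have "(v, x) = f (Suc i)"
        using dstar_eq[OF \<open>(u, v, x) \<in> W\<close>] by (simp add: f_def)
      then show "(v, x) \<in> range f"
        by simp
    qed
    then show "Rstar W \<subseteq> range f"
      by (rule conn) (auto simp: f_def intro: image_eqI[of _ _ 0])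
  qed (auto simp: f_def funpow_dstar_in e)
  have cancel: "f p = e" if "f i = f (i + p)" for i p
    using funpow_dstar_cancel[OF e] that unfolding f_def by blast
  have "\<not> inj f"
    using range finite_Rstar finite_imageD infinite_UNIV_nat by metis
  then obtain i j where "f i = f j" "i < j"
    by (metis linorder_injI)
  then have "f (j - i) = e" "j - i > 0"
    using cancel[of i "j - i"] by auto
  then obtain p where p: "p > 0" "f p = e" and min: "\<And>q. q < p \<Longrightarrow> q > 0 \<Longrightarrow> f q \<noteq> e"
    using exists_least_iff[of "\<lambda>p. p > 0 \<and> f p = e"] by blast
  have inj: "inj_on f {..<p}"
  proof (rule linorder_inj_onI)
    fix i j assume "i < j" "i \<in> {..<p}" "j \<in> {..<p}"
    then show "f i \<noteq> f j"
      using cancel[of i "j - i"] min[of "j - i"] by auto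
  qed auto
  have "f i = f (i mod p)" for i
    using funpow_mod_eq[of p "dstar W" e i] p unfolding f_def by simp
  then have "f ` {..<p} = range f"
    using p(1) by (metis (no_types, lifting) UNIV_I image_eqI image_subsetI lessThan_iff
        mod_less_divisor subset_antisym subset_UNIV image_mono)
  then have "f ` {..<p} = Rstar W"
    by (simp add: range)
  moreover from this have "n = p"
    using card_image[OF inj] by (simp add: n_def)
  ultimately show "f n = e" "inj_on f {..<n}" "f ` {..<n} = Rstar W"
    using p inj by auto
qed

end


section \<open>Cycles and degrees\<close>

locale cyclic_list =
  fixes vs :: "'a list"
  assumes length: "3 \<le> length vs" and distinct: "distinct vs"
begin

text \<open>Positions run from 1 and are unique on a distinct list. Through \<open>pos\<close>,
  cyclic neighbours become functions of nodes instead of indices.\<close>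

definition pos :: "'a \<Rightarrow> nat" where
  "pos w = (THE i. i \<in> {1..length vs} \<and> cyc vs i = w)"

definition nxt :: "'a \<Rightarrow> 'a" where
  "nxt w = cyc vs (pos w + 1)"

definition prv :: "'a \<Rightarrow> 'a" where
  "prv w = cyc vs (pos w - 1)"

lemma cyc_nth: "i \<in> {1..length vs} \<Longrightarrow> cyc vs i = vs ! (i - 1)"
proof -
  assume "i \<in> {1..length vs}"
  then have "i + length vs - 1 = (i - 1) + length vs" "i - 1 < length vs"
    by auto
  then show ?thesis
    by (simp only: cyc_def mod_add_self2 mod_less)
qed

lemma cyc_add_length: "cyc vs (i + length vs) = cyc vs i"
proof -
  have "i + length vs + length vs - 1 = (i + length vs - 1) + length vs"
    using length by auto
  then show ?thesis
    by (simp add: cyc_def)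
qed

lemma cyc_0: "cyc vs 0 = cyc vs (length vs)" and cyc_Suc_length: "cyc vs (Suc (length vs)) = cyc vs 1"
  using cyc_add_length[of 0] cyc_add_length[of 1] by simp_all

lemma cyc_inj: "i \<in> {1..length vs} \<Longrightarrow> i' \<in> {1..length vs} \<Longrightarrow> cyc vs i = cyc vs i' \<longleftrightarrow> i = i'"
  using distinct by (auto simp: cyc_nth nth_eq_iff_index_eq)

lemma set_eq_cyc: "set vs = cyc vs ` {1..length vs}"
proof -
  have "set vs = (\<lambda>i. vs ! (i - 1)) ` {1..length vs}"
    unfolding set_conv_nth
    by (force intro!: image_eqI[of _ _ "Suc _"])
  also have "\<dots> = cyc vs ` {1..length vs}"
    by (rule image_cong) (simp_all only: cyc_nth)
  finally show ?thesis .
qed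

lemma pos_cyc: "i \<in> {1..length vs} \<Longrightarrow> pos (cyc vs i) = i"
  unfolding pos_def using cyc_inj by (intro the_equality) auto

lemma nxt_cyc: "i \<in> {1..length vs} \<Longrightarrow> nxt (cyc vs i) = cyc vs (i + 1)"
  and prv_cyc: "i \<in> {1..length vs} \<Longrightarrow> prv (cyc vs i) = cyc vs (i - 1)"
  by (simp_all add: nxt_def prv_def pos_cyc)

text \<open>Positions where the index wraps around are treated separately. The bound
  \<open>3 \<le> length vs\<close> gives \<open>nxt (nxt w) \<noteq> w\<close>, which later prevents
  a cycle from containing both orientations of an edge.\<close>

lemma prv_nxt: "w \<in> set vs \<Longrightarrow> prv (nxt w) = w \<and> nxt w \<in> set vs"
  and nxt_prv: "w \<in> set vs \<Longrightarrow> nxt (prv w) = w \<and> prv w \<in> set vs"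
  and nxt_nxt: "w \<in> set vs \<Longrightarrow> nxt (nxt w) \<noteq> w"
  and nxt_neq: "w \<in> set vs \<Longrightarrow> nxt w \<noteq> w"
proof -
  assume "w \<in> set vs"
  then obtain i where i: "i \<in> {1..length vs}" and w: "w = cyc vs i"
    by (auto simp: set_eq_cyc)
  have 1: "1 \<in> {1..length vs}" "2 \<in> {1..length vs}" "length vs \<in> {1..length vs}"
    using length by auto
  have "prv (nxt w) = w \<and> nxt w \<in> set vs \<and> nxt (nxt w) \<noteq> w \<and> nxt w \<noteq> w"
  proof (cases "i = length vs")
    case True
    then have "nxt w = cyc vs 1" "nxt (nxt w) = cyc vs 2"
      using i 1 w by (simp_all add: nxt_cyc cyc_Suc_length numeral_2_eq_2)
    then show ?thesis
      using True w 1 length cyc_inj[of _ i] by (auto simp: set_eq_cyc prv_cyc cyc_0)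
  next
    case False
    then have Suc: "Suc i \<in> {1..length vs}"
      using i by auto
    have n: "nxt w = cyc vs (Suc i)"
      using i w by (simp add: nxt_cyc)
    have "nxt (nxt w) \<noteq> w"
    proof (cases "Suc i = length vs")
      case True
      then have "nxt (nxt w) = cyc vs 1"
        using n nxt_cyc[OF Suc] cyc_Suc_length by simp
      then show ?thesis
        using True length w i 1 cyc_inj[of 1 i] by auto
    next
      case False
      then have "Suc (Suc i) \<in> {1..length vs}"
        using Suc by auto
      then show ?thesis
        using w i n nxt_cyc[OF Suc] cyc_inj[of "Suc (Suc i)" i] by auto
    qed
    then show ?thesis
      using w i Suc n cyc_inj[OF Suc i] by (auto simp: set_eq_cyc prv_cyc)
  qed
  then show "prv (nxt w) = w \<and> nxt w \<in> set vs" "nxt (nxt w) \<noteq> w" "nxt w \<noteq> w"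
    by auto
  show "nxt (prv w) = w \<and> prv w \<in> set vs"
  proof (cases "i = 1")
    case True
    then show ?thesis
      using 1 w by (auto simp: prv_cyc cyc_0 nxt_cyc cyc_Suc_length set_eq_cyc)
  next
    case False
    then have "i - 1 \<in> {1..length vs}"
      using i by auto
    then show ?thesis
      using i w by (auto simp: prv_cyc nxt_cyc set_eq_cyc)
  qed
qed

lemma nxt_invariant:
  assumes "\<And>w. w \<in> set vs \<Longrightarrow> P w \<longleftrightarrow> P (nxt w)" and "w \<in> set vs" "w' \<in> set vs"
  shows "P w \<longleftrightarrow> P w'"
proof -
  have *: "i \<in> {1..length vs} \<Longrightarrow> P (cyc vs i) \<longleftrightarrow> P (cyc vs 1)" for i
  proof (induction i)
    case (Suc i)
    show ?case
    proof (cases "i = 0")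
      case False
      then have "i \<in> {1..length vs}"
        using Suc.prems by auto
      then show ?thesis
        using Suc.IH assms(1)[of "cyc vs i"] by (auto simp: nxt_cyc set_eq_cyc)
    qed simp
  qed simp
  then show ?thesis
    using assms(2,3) unfolding set_eq_cyc by (metis imageE)
qed

text \<open>These identities turn the indexed sets of \<open>merge_cycle\<close> into sets over
  nodes, where each cycle edge is named by its target \<open>w\<close>.\<close>

lemma pair_set_cyc:
  shows "{(cyc vs (i - 1), cyc vs i) | i. i \<in> {1..length vs} \<and> P (cyc vs i)}
      = {(prv w, w) | w. w \<in> set vs \<and> P w}"
    and "{(cyc vs (i - 1), cyc vs i, h (cyc vs i)) | i. i \<in> {1..length vs} \<and> P (cyc vs i)}
      = {(prv w, w, h w) | w. w \<in> set vs \<and> P w}"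
    and "{{cyc vs i, cyc vs (i + 1)} | i. i \<in> {1..length vs}} = {{prv w, w} | w. w \<in> set vs}"
    and "{(cyc vs i, cyc vs (i + 1), cyc vs (i + 2)) | i. i \<in> {1..length vs} \<and> Q (cyc vs i) (cyc vs (i + 1))}
      = {(prv w, w, nxt w) | w. w \<in> set vs \<and> Q (prv w) w}"
proof -
  show "{(cyc vs (i - 1), cyc vs i) | i. i \<in> {1..length vs} \<and> P (cyc vs i)}
      = {(prv w, w) | w. w \<in> set vs \<and> P w}"
    using prv_cyc unfolding set_eq_cyc by force
  show "{(cyc vs (i - 1), cyc vs i, h (cyc vs i)) | i. i \<in> {1..length vs} \<and> P (cyc vs i)}
      = {(prv w, w, h w) | w. w \<in> set vs \<and> P w}"
    using prv_cyc unfolding set_eq_cyc by force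
  have U: "(\<exists>i. i \<in> {1..length vs} \<and> S (cyc vs i)) \<longleftrightarrow> (\<exists>w. w \<in> set vs \<and> S w)" for S
    unfolding set_eq_cyc by auto
  have shift: "(\<exists>w. w \<in> set vs \<and> S w (nxt w)) \<longleftrightarrow> (\<exists>w. w \<in> set vs \<and> S (prv w) w)" for S
    using prv_nxt nxt_prv by metis
  \<comment> \<open>For the last position, \<open>i + 2\<close> wraps around to position 2.\<close>
  have two: "cyc vs (i + 2) = nxt (nxt (cyc vs i))" if "i \<in> {1..length vs}" for i
  proof (cases "i = length vs")
    case True
    then show ?thesis
      using that length cyc_add_length[of 2] by (simp add: nxt_cyc cyc_Suc_length add.commute numeral_2_eq_2)
  next
    case False
    then show ?thesis
      using that by (simp add: nxt_cyc)
  qed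
  have "e \<in> {{cyc vs i, cyc vs (i + 1)} | i. i \<in> {1..length vs}}
      \<longleftrightarrow> (\<exists>i. i \<in> {1..length vs} \<and> e = {cyc vs i, nxt (cyc vs i)})" for e
    by (auto simp: nxt_cyc)
  then show "{{cyc vs i, cyc vs (i + 1)} | i. i \<in> {1..length vs}} = {{prv w, w} | w. w \<in> set vs}"
    unfolding U[of "\<lambda>w. _ = {w, nxt w}"] shift[of "\<lambda>v w. _ = {v, w}"] by blast
  have "e \<in> {(cyc vs i, cyc vs (i + 1), cyc vs (i + 2)) | i. i \<in> {1..length vs} \<and> Q (cyc vs i) (cyc vs (i + 1))}
      \<longleftrightarrow> (\<exists>i. i \<in> {1..length vs} \<and> e = (cyc vs i, nxt (cyc vs i), nxt (nxt (cyc vs i))) \<and>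
            Q (cyc vs i) (nxt (cyc vs i)))" for e
    using two nxt_cyc by fastforce
  then show "{(cyc vs i, cyc vs (i + 1), cyc vs (i + 2)) | i. i \<in> {1..length vs} \<and> Q (cyc vs i) (cyc vs (i + 1))}
      = {(prv w, w, nxt w) | w. w \<in> set vs \<and> Q (prv w) w}"
    unfolding U[of "\<lambda>w. _ = (w, nxt w, nxt (nxt w)) \<and> Q w (nxt w)"]
      shift[of "\<lambda>v w. _ = (v, w, nxt w) \<and> Q v w"] by blast
qed

text \<open>Induction on the number of iterations carried out. A node has one position, so the value
  assigned at it is its \<open>nxt\<close>.\<close>

lemma set_succs_eq:
  "set_succs vs P j = (\<lambda>u. if u \<in> set vs \<and> P u then Some (nxt u) else j u)"
proof -
  have "n \<le> length vs \<Longrightarrow>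
    fold (\<lambda>i j. if P (cyc vs i) then j(cyc vs i := Some (cyc vs (i + 1))) else j) [1..<n + 1] j
      = (\<lambda>u. if u \<in> cyc vs ` {1..n} \<and> P u then Some (nxt u) else j u)" for n
  proof (induction n)
    case (Suc n)
    have "{1..Suc n} = insert (Suc n) {1..n}" and upt: "[1..<Suc n + 1] = [1..<n + 1] @ [Suc n]"
      by auto
    moreover have "nxt (cyc vs (Suc n)) = cyc vs (Suc n + 1)"
      using Suc.prems by (intro nxt_cyc) auto
    ultimately show ?case
      using Suc.prems unfolding upt fold_append o_apply Suc.IH[OF Suc_leD[OF Suc.prems]]
      by (auto simp: fun_eq_iff)
  qed simp
  then show ?thesis
    unfolding set_succs_def set_eq_cyc by blast
qed

end

section \<open>Degree parity and the existence of cycles\<close>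

lemma is_cycle_mono: "is_cycle V H vs \<Longrightarrow> H \<subseteq> H' \<Longrightarrow> is_cycle V H' vs"
  by (auto simp: is_cycle_def)

text \<open>Without loops no edge both leaves and enters \<open>v\<close>, and injectivity of
  \<open>undirected\<close> keeps the edges apart when orientation is forgotten. So the degree is
  twice the out-degree.\<close>

lemma even_degree_balanced:
  assumes "finite A" and inj: "inj_on undirected A" and loop: "\<And>x. x \<in> A \<Longrightarrow> fst x \<noteq> snd x"
    and balanced: "card {x \<in> A. fst x = v} = card {x \<in> A. snd x = v}"
  shows "even (card {e \<in> undirected ` A. v \<in> e})"
proof -
  have "{e \<in> undirected ` A. v \<in> e} = undirected ` ({x \<in> A. fst x = v} \<union> {x \<in> A. snd x = v})"
    by (auto simp: undirected_def)
  also have "card \<dots> = card ({x \<in> A. fst x = v} \<union> {x \<in> A. snd x = v})"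
    by (rule card_image) (auto intro: inj_on_subset[OF inj])
  also have "\<dots> = card {x \<in> A. fst x = v} + card {x \<in> A. snd x = v}"
    using assms(1) by (intro card_Un_disjoint) (force dest: loop)+
  finally show ?thesis
    by (simp add: balanced)
qed

lemma steps_Cons_Cons: "steps (a # b # ws) = (a, b) # steps (b # ws)"
  by (simp add: steps_def)

lemma map_fst_steps: "map fst (steps ws) = butlast ws"
  and map_snd_steps: "map snd (steps ws) = tl ws"
  by (induction ws rule: induct_list012) (simp_all add: steps_def)

lemma card_filter_set: "distinct xs \<Longrightarrow> card {x \<in> set xs. f x = v} = count_list (map f xs) v"
proof (induction xs)
  case (Cons a xs)
  have "{x \<in> set (a # xs). f x = v} =
      (if f a = v then insert a {x \<in> set xs. f x = v} else {x \<in> set xs. f x = v})"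
    by auto
  then show ?case
    using Cons by simp
qed simp

text \<open>Orient each edge along the closed trail. Since the first and last nodes agree, every
  node is left as often as it is entered.\<close>

lemma even_degree_eulerian:
  assumes simple: "simple_graph V E" and "eulerian V E"
  shows "even (card {e \<in> E. v \<in> e})"
proof -
  obtain ws where ws: "ws \<noteq> []" "hd ws = last ws" "distinct (map undirected (steps ws))"
      "set (map undirected (steps ws)) = E"
    using assms(2) by (auto simp: eulerian_def)
  have "count_list (butlast ws) v = count_list (tl ws) v"
  proof -
    have "count_list (hd ws # tl ws) v = count_list (butlast ws @ [last ws]) v"
      using ws(1) by simp
    then show ?thesis
      using ws(2) by (simp split: if_splits)
  qed
  moreover have "distinct (steps ws)" "inj_on undirected (set (steps ws))"
    using ws(3) by (auto simp: distinct_map)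
  moreover have "fst x \<noteq> snd x" if "x \<in> set (steps ws)" for x
    using simple that ws(4) by (fastforce simp: simple_graph_def undirected_def)
  ultimately show ?thesis
    using even_degree_balanced[of "set (steps ws)" v] ws(4)
    by (simp add: card_filter_set map_fst_steps map_snd_steps)
qed

text \<open>Longest-path argument: by evenness the first node of a longest path has a second
  incident edge; by maximality its other end lies on the path, so the edge closes a cycle.\<close>

lemma even_degrees_cycle:
  assumes simple: "simple_graph V H" and "H \<noteq> {}" and even: "\<And>v. even (card {e \<in> H. v \<in> e})"
  shows "\<exists>vs. is_cycle V H vs"
proof -
  define path where "path ps \<longleftrightarrow> distinct ps \<and> set ps \<subseteq> V \<and> 2 \<le> length ps \<and>
    (\<forall>i. Suc i < length ps \<longrightarrow> {ps ! i, ps ! Suc i} \<in> H)" for ps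
  have finV: "finite V" and H: "\<And>e. e \<in> H \<Longrightarrow> e \<subseteq> V \<and> card e = 2"
    using simple by (auto simp: simple_graph_def)
  have "finite H"
    using H finV by (meson Pow_iff finite_Pow_iff finite_subset subsetI)
  obtain e where "e \<in> H"
    using assms(2) by auto
  then obtain a b where "e = {a, b}" "a \<noteq> b"
    using H by (meson card_2_iff)
  then have "path [a, b]"
    using H \<open>e \<in> H\<close> by (auto simp: path_def)
  moreover have "length ps < Suc (card V)" if "path ps" for ps
    using that finV card_mono[of V "set ps"] by (auto simp: path_def distinct_card)
  ultimately obtain ps where ps: "path ps" and max: "\<And>qs. path qs \<Longrightarrow> length qs \<le> length ps"
    using ex_has_greatest_nat[of path "[a, b]" length "Suc (card V)"] by blast
  define w where "w = ps ! 0"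
  have "w \<in> set ps"
    unfolding w_def using ps by (intro nth_mem) (auto simp: path_def)
  then have first: "{w, ps ! 1} \<in> H" "w \<in> V"
    using ps by (auto simp: path_def w_def)
  have "\<exists>e' \<in> H. w \<in> e' \<and> e' \<noteq> {w, ps ! 1}"
  proof (rule ccontr)
    assume "\<not> ?thesis"
    then have "{e \<in> H. w \<in> e} = {{w, ps ! 1}}"
      using first by blast
    then show False
      using even[of w] by simp
  qed
  then obtain e' where e': "e' \<in> H" "w \<in> e'" "e' \<noteq> {w, ps ! 1}"
    by blast
  then obtain x where x: "e' = {w, x}" "x \<noteq> w"
    using H[OF e'(1)] by (metis card_2_iff doubleton_eq_iff insertE singletonD)
  have "x \<in> set ps"
  proof (rule ccontr)
    assume "x \<notin> set ps"
    have "path (x # ps)"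
      unfolding path_def
    proof (intro conjI allI impI)
      fix i assume "Suc i < length (x # ps)"
      then show "{(x # ps) ! i, (x # ps) ! Suc i} \<in> H"
        using ps e' x by (cases i) (auto simp: path_def w_def insert_commute)
    qed (use ps \<open>x \<notin> set ps\<close> H[OF e'(1)] x in \<open>auto simp: path_def\<close>)
    then show False
      using max by fastforce
  qed
  then obtain i where i: "i < length ps" "x = ps ! i"
    by (auto simp: in_set_conv_nth)
  \<comment> \<open>\<open>e'\<close> is not a loop and differs from the first edge of the path, so
    the closed segment has at least three nodes.\<close>
  have "i \<noteq> 0" "i \<noteq> 1"
    using i x e' by (auto simp: w_def)
  let ?vs = "take (Suc i) ps"
  have len: "length ?vs = Suc i"
    using i by simp
  have "is_cycle V H ?vs"
    unfolding is_cycle_def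
  proof (intro conjI ballI)
    fix l assume l: "l \<in> {1..length ?vs}"
    interpret cyclic_list ?vs
      by unfold_locales (use \<open>i \<noteq> 0\<close> \<open>i \<noteq> 1\<close> i ps in \<open>auto simp: path_def\<close>)
    show "{cyc ?vs l, cyc ?vs (l + 1)} \<in> H"
    proof (cases "l = Suc i")
      case True
      have "cyc ?vs l = x" "cyc ?vs (l + 1) = w"
        using cyc_nth[of "Suc i"] cyc_nth[of 1] cyc_Suc_length True len i
        by (simp_all add: w_def)
      then show ?thesis
        using e' x by (simp add: insert_commute)
    next
      case False
      then have "cyc ?vs l = ps ! (l - 1)" "cyc ?vs (l + 1) = ps ! l"
        using cyc_nth[of l] cyc_nth[of "l + 1"] l len by auto
      then show ?thesis
        using ps l False i unfolding path_def by (auto dest!: spec[of _ "l - 1"])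
    qed
  qed (use \<open>i \<noteq> 0\<close> \<open>i \<noteq> 1\<close> i ps in \<open>auto simp: path_def dest: in_set_takeD\<close>)
  then show ?thesis
    by blast
qed


section \<open>The invariant\<close>

text \<open>\<open>D\<close> holds the edges read so far. By \<open>F_ex\<close> and
  \<open>F_unique\<close>, every labelled node has exactly one entering edge whose successor is
  still open; a later merge exchanges it. \<open>classes\<close> puts edges with equal labels on one
  orbit. \<open>tval_le\<close> and \<open>cnt_le\<close> bound the labels by the number of
  nodes.\<close>

locale et_invariant =
  fixes V :: "'a set" and D :: "'a set set" and s :: "'a et_state"
  assumes finite_nodes: "finite V"
    and edges_in: "Rstar (final_written s) \<subseteq> V \<times> V"
    and no_loop: "(u, v) \<in> Rstar (final_written s) \<Longrightarrow> u \<noteq> v"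
    and F_unwritten: "(u, v) \<in> Fset s \<Longrightarrow> (u, v, x) \<notin> written s"
    and F_ex: "tval s v \<noteq> 0 \<Longrightarrow> \<exists>u. (u, v) \<in> Fset s"
    and F_unique: "(u, v) \<in> Fset s \<Longrightarrow> (w, v) \<in> Fset s \<Longrightarrow> u = w"
    and tval_edge: "(u, v) \<in> Rstar (final_written s) \<Longrightarrow> tval s u = tval s v \<and> tval s v \<noteq> 0"
    and tval_le: "tval s v \<le> cnt s"
    and cnt_le: "cnt s \<le> card {v \<in> V. tval s v \<noteq> 0}"
    and perm: "successor_permutation (final_written s)"
    and classes: "closed_under (final_written s) P \<Longrightarrow> (u, v) \<in> P \<Longrightarrow>
        (u, v) \<in> Rstar (final_written s) \<Longrightarrow> (u', v') \<in> Rstar (final_written s) \<Longrightarrow>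
        tval s v = tval s v' \<Longrightarrow> (u', v') \<in> P"
    and orientation: "inj_on undirected (Rstar (final_written s))"
    and disjoint: "undirected ` Rstar (final_written s) \<inter> Eint s = {}"
    and edges_read: "undirected ` Rstar (final_written s) \<union> Eint s = D"

lemma et_invariant_init: "finite V \<Longrightarrow> et_invariant V {} init_state"
  by unfold_locales (auto simp: init_state_def final_written_def Rstar_def)

lemma (in et_invariant) read:
  assumes "e \<notin> D"
  shows "et_invariant V (insert e D) (s\<lparr>Eint := insert e (Eint s)\<rparr>)"
proof -
  have "final_written (s\<lparr>Eint := insert e (Eint s)\<rparr>) = final_written s"
    by (simp add: final_written_def)
  then show ?thesis
    using et_invariant_axioms assms by (simp add: et_invariant_def) blast
qed

text \<open>Applied after the new edge has been inserted into \<open>Eint s\<close> and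
  \<open>D\<close>, so that the whole cycle lies in \<open>Eint s\<close>.\<close>

locale merge = et_invariant V D s + cyclic_list vs
  for V :: "'a set" and D s and vs :: "'a list" +
  fixes J :: "'a set"
  assumes cycle: "is_cycle V (Eint s) vs" and selection: "is_selection V vs (tval s) J"
begin

abbreviation t :: "'a \<Rightarrow> nat" where "t \<equiv> tval s"
abbreviation M :: "nat set" where "M \<equiv> cycle_classes V vs t"
abbreviation W :: "('a \<times> 'a \<times> 'a) set" where "W \<equiv> final_written s"
abbreviation C :: "('a \<times> 'a) set" where "C \<equiv> {(prv w, w) | w. w \<in> set vs}"
abbreviation s' :: "'a et_state" where "s' \<equiv> merge_cycle V vs J s"
abbreviation W' :: "('a \<times> 'a \<times> 'a) set" where "W' \<equiv> final_written s'"

interpretation old: successor_permutation W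
  by (rule perm)

lemma cycle_nodes: "set vs \<subseteq> V"
  using cycle by (auto simp: is_cycle_def)

text \<open>\<open>cycle_classes\<close> inspects only labels up to \<open>card V\<close>. None is
  missed: a label is at most \<open>cnt s\<close>, hence at most the number of labelled
  nodes.\<close>

lemma M_eq: "M = {t w | w. w \<in> set vs \<and> t w \<noteq> 0}"
proof -
  have "t w \<le> card V" for w
    using tval_le[of w] cnt_le card_mono[of V "{v \<in> V. t v \<noteq> 0}"] finite_nodes by fastforce
  then show ?thesis
    by (auto simp: cycle_classes_def Suc_le_eq)
qed

lemma J_sub: "w \<in> J \<Longrightarrow> w \<in> set vs \<and> t w \<noteq> 0"
  using selection by (auto simp: is_selection_def cycle_classes_def)

lemma J_unique: "v \<in> J \<Longrightarrow> w \<in> J \<Longrightarrow> t v = t w \<Longrightarrow> v = w"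
  using selection J_sub M_eq unfolding is_selection_def by blast

lemma J_ex: "m \<in> M \<Longrightarrow> \<exists>w \<in> J. t w = m"
  using selection unfolding is_selection_def by blast

lemma cycle_edges: "{{prv w, w} | w. w \<in> set vs} \<subseteq> Eint s"
  using cycle unfolding pair_set_cyc(3)[symmetric] by (auto simp: is_cycle_def)

lemma undirected_C: "undirected ` C = {{prv w, w} | w. w \<in> set vs}"
proof -
  have "undirected ` C = {undirected (prv w, w) | w. w \<in> set vs}"
    by blast
  then show ?thesis
    by (simp add: undirected_def)
qed

lemma C_new: "w \<in> set vs \<Longrightarrow> (prv w, w) \<notin> Rstar W"
  using cycle_edges disjoint imageI[of "(prv w, w)" "Rstar W" undirected]
  by (auto simp: undirected_def)

lemma C_unwritten: "w \<in> set vs \<Longrightarrow> (prv w, w, x) \<notin> written s \<and> (prv w, w) \<notin> Fset s"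
  using C_new by (auto simp: Rstar_def final_written_def)

lemma W_iff: "(u, v, x) \<in> W \<longleftrightarrow> (u, v, x) \<in> written s \<or> (u, v) \<in> Fset s \<and> x = the (jval s v)"
  by (auto simp: final_written_def)

lemma F_edge: "(u, v) \<in> Fset s \<Longrightarrow> (u, v) \<in> Rstar W"
  by (auto simp: Rstar_def W_iff)

lemma F_tval: "(u, v) \<in> Fset s \<Longrightarrow> t v \<noteq> 0"
  using F_edge tval_edge by blast

text \<open>A cycle edge \<open>(prv w, w)\<close> is put into \<open>Fset s'\<close> if
  \<open>t w = 0\<close>, written with the old \<open>j\<close> if \<open>w \<in> J\<close>, and
  written with \<open>nxt w\<close> otherwise.\<close>

lemma fields:
  "cnt s' = (if M = {} then cnt s + 1 else cnt s)"
  "Fset s' = Fset s \<union> {(prv w, w) | w. w \<in> set vs \<and> t w = 0}"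
  "Eint s' = Eint s - undirected ` C"
  "jval s' = (\<lambda>u. if u \<in> set vs \<and> (u \<in> J \<or> t u = 0) then Some (nxt u) else jval s u)"
  "tval s' = (\<lambda>u. if u \<in> set vs \<or> u \<in> V \<and> t u \<in> M then (if M = {} then cnt s + 1 else Min M) else t u)"
  "written s' = written s \<union> {(prv w, w, the (jval s w)) | w. w \<in> J}
     \<union> {(prv w, w, nxt w) | w. w \<in> set vs \<and> w \<notin> J \<and> t w \<noteq> 0}"
proof -
  note defs = merge_cycle_def Let_def set_succs_eq
  show "cnt s' = (if M = {} then cnt s + 1 else cnt s)"
    "tval s' = (\<lambda>u. if u \<in> set vs \<or> u \<in> V \<and> t u \<in> M then (if M = {} then cnt s + 1 else Min M) else t u)"
    by (simp_all add: defs)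
  show F: "Fset s' = Fset s \<union> {(prv w, w) | w. w \<in> set vs \<and> t w = 0}"
    using pair_set_cyc(1)[of "\<lambda>w. t w = 0"] by (simp add: defs)
  show "Eint s' = Eint s - undirected ` C"
    using pair_set_cyc(3) undirected_C by (simp add: defs)
  show "jval s' = (\<lambda>u. if u \<in> set vs \<and> (u \<in> J \<or> t u = 0) then Some (nxt u) else jval s u)"
    by (auto simp: defs)
  define j1 where "j1 = set_succs vs (\<lambda>u. t u = 0) (jval s)"
  define W3 where "W3 = written s \<union>
    {(cyc vs (i - 1), cyc vs i, the (j1 (cyc vs i))) | i. i \<in> {1..length vs} \<and> cyc vs i \<in> J}"
  have W3: "W3 = written s \<union> {(prv w, w, the (jval s w)) | w. w \<in> J}"
  proof -
    \<comment> \<open>Nodes of \<open>J\<close> carry nonzero labels, so the first loop leaves their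
      \<open>j\<close> unchanged.\<close>
    have "j1 w = jval s w" if "w \<in> J" for w
      using J_sub[OF that] by (simp add: j1_def set_succs_eq)
    then have "{(prv w, w, the (j1 w)) | w. w \<in> set vs \<and> w \<in> J} = {(prv w, w, the (jval s w)) | w. w \<in> J}"
      by (intro Collect_cong) (metis J_sub)
    then show ?thesis
      unfolding W3_def pair_set_cyc(2)[of "\<lambda>w. the (j1 w)" "\<lambda>w. w \<in> J"] by simp
  qed
  define Q where "Q u v \<longleftrightarrow> (\<forall>x. (u, v, x) \<notin> W3) \<and> (u, v) \<notin> Fset s'" for u v
  have Q: "Q (prv w) w \<longleftrightarrow> w \<notin> J \<and> t w \<noteq> 0" if "w \<in> set vs" for w
    using C_unwritten[OF that] that unfolding Q_def F W3 by auto
  have "written s' = W3 \<union> {(cyc vs i, cyc vs (i + 1), cyc vs (i + 2)) | i.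
      i \<in> {1..length vs} \<and> Q (cyc vs i) (cyc vs (i + 1))}"
    unfolding Q_def W3_def j1_def by (simp add: merge_cycle_def Let_def)
  also have "\<dots> = W3 \<union> {(prv w, w, nxt w) | w. w \<in> set vs \<and> Q (prv w) w}"
    unfolding pair_set_cyc(4) ..
  finally show "written s' = written s \<union> {(prv w, w, the (jval s w)) | w. w \<in> J}
     \<union> {(prv w, w, nxt w) | w. w \<in> set vs \<and> w \<notin> J \<and> t w \<noteq> 0}"
    using Q W3 by auto
qed

text \<open>Merging exchanges the successors of the cycle edge and of the edge in \<open>F\<close> entering each
  node of \<open>J\<close>.\<close>

lemma W'_iff: "(u, v, x) \<in> W' \<longleftrightarrow>
    (u, v, x) \<in> written s \<or>
    (u, v) \<in> Fset s \<and> v \<notin> J \<and> x = the (jval s v) \<or>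
    (u, v) \<in> Fset s \<and> v \<in> J \<and> x = nxt v \<or>
    v \<in> J \<and> u = prv v \<and> x = the (jval s v) \<or>
    v \<in> set vs \<and> v \<notin> J \<and> u = prv v \<and> x = nxt v"
proof -
  \<comment> \<open>No edge of \<open>Fset s\<close> enters an unlabelled node, so the values of
    \<open>j\<close> set at such nodes affect only the new edges of \<open>Fset s'\<close>.\<close>
  have "(u, v) \<in> Fset s' \<and> x = the (jval s' v) \<longleftrightarrow>
      (u, v) \<in> Fset s \<and> x = (if v \<in> J then nxt v else the (jval s v)) \<or>
      v \<in> set vs \<and> t v = 0 \<and> u = prv v \<and> x = nxt v"
    using J_sub[of v] F_tval[of u v] by (auto simp: fields)
  moreover have "(u, v, x) \<in> W' \<longleftrightarrow>
      (u, v, x) \<in> written s' \<or> (u, v) \<in> Fset s' \<and> x = the (jval s' v)"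
    by (auto simp: final_written_def)
  ultimately show ?thesis
    using J_sub[of v] by (auto simp: fields(6))
qed

lemma Rstar_W': "Rstar W' = Rstar W \<union> C"
proof -
  have "(u, v) \<in> Rstar W' \<longleftrightarrow> (u, v) \<in> Rstar W \<union> C" for u v
    using J_sub by (auto simp: Rstar_def W'_iff W_iff)
  then show ?thesis
    by auto
qed

lemma J_F: "w \<in> J \<Longrightarrow> \<exists>u. (u, w) \<in> Fset s"
  using J_sub F_ex by blast

lemma j_old: "w \<in> J \<Longrightarrow> (w, the (jval s w)) \<in> Rstar W"
  using J_F old.into W_iff by metis

lemma nxt_new: "w \<in> set vs \<Longrightarrow> (w, nxt w) \<in> C"
  using prv_nxt by fastforce

text \<open>Adding a cycle as a new orbit and exchanging successors in pairs both preserve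
  permutations. For injectivity, \<open>(v, nxt v)\<close> is never an old successor because cycle
  edges are new.\<close>

lemma perm': "successor_permutation W'"
proof
  show "finite (Rstar W')"
    using old.finite_Rstar by (simp add: Rstar_W')
next
  fix u v x y assume "(u, v, x) \<in> W'" "(u, v, y) \<in> W'"
  then show "x = y"
    using F_unwritten C_unwritten J_sub old.functional[of u v x y] unfolding W'_iff W_iff by metis
next
  fix u v x w assume *: "(u, v, x) \<in> W'" "(w, v, x) \<in> W'"
  have old: "(v, x) \<in> Rstar W" if "(u, v, x) \<in> written s" for u
    using that old.into W_iff by blast
  have oldF: "(v, the (jval s v)) \<in> Rstar W" if "(u, v) \<in> Fset s" for u
    using that old.into W_iff by blast
  have new: "(v, nxt v) \<notin> Rstar W" if "v \<in> set vs"
    using C_new prv_nxt that by metis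
  have written: "u = w" if "(u, v, x) \<in> written s" "(w, v, x) \<in> written s" for u w
    using that old.injective W_iff by metis
  have mixed: "u = w" if "(u, v, x) \<in> written s" "(w, v) \<in> Fset s" "x = the (jval s v)" for u w
    using that old.injective W_iff by metis
  \<comment> \<open>The edge of \<open>Fset s\<close> entering \<open>v\<close> already has this
    successor, so by injectivity of \<open>W\<close> no written edge has it too.\<close>
  have clash: "\<not> (u, v, the (jval s v)) \<in> written s" if "v \<in> J" for u
    using that mixed J_F F_unwritten old.injective W_iff by metis
  show "u = w"
    using * old oldF new written mixed clash J_sub j_old F_unique unfolding W'_iff by metis
next
  fix u v x assume "(u, v, x) \<in> W'"
  then show "(v, x) \<in> Rstar W'"
    unfolding W'_iff Rstar_W' using old.into W_iff j_old nxt_new J_sub by blast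
qed

interpretation new: successor_permutation W'
  by (rule perm')

text \<open>Within an old class only the edge entering the selected node gets a new successor.
  Depending on whether its old successor lies in \<open>P\<close>, the part of the class inside \<open>P\<close> or the
  part outside is closed under the old successor map, hence empty or the whole class.\<close>

lemma old_class:
  assumes P: "closed_under W' P" and x: "(u, v) \<in> Rstar W" "(u', v') \<in> Rstar W" "t v = t v'"
  shows "(u, v) \<in> P \<longleftrightarrow> (u', v') \<in> P"
proof -
  \<comment> \<open>At most one node of \<open>J\<close> has the label \<open>t v\<close>, so
    \<open>b\<close> records whether the old successor there lies in \<open>P\<close>. If there is
    no such node, \<open>b\<close> is true.\<close>
  define b where "b \<longleftrightarrow> (\<forall>w \<in> J. t w = t v \<longrightarrow> (w, the (jval s w)) \<in> P)"
  define Q where "Q = {e. t (snd e) = t v \<and> (e \<in> P \<longleftrightarrow> b)}"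
  have "closed_under W Q"
    unfolding closed_under_def
  proof (intro allI impI)
    fix p q r assume W: "(p, q, r) \<in> W" and Q: "(p, q) \<in> Q"
    then have t: "t q = t v" "t r = t v" and b: "(p, q) \<in> P \<longleftrightarrow> b"
      using tval_edge[OF old.into[OF W]] by (auto simp: Q_def)
    show "(q, r) \<in> Q"
    proof (cases "(p, q) \<in> Fset s \<and> q \<in> J")
      \<comment> \<open>The only place where the successor changes; the choice of \<open>b\<close>
        puts the old successor into \<open>Q\<close>.\<close>
      case True
      then have "r = the (jval s q)"
        using W F_unwritten by (auto simp: W_iff)
      then have "(q, r) \<in> P \<longleftrightarrow> b"
        using True t J_unique unfolding b_def by metis
      then show ?thesis
        using t by (simp add: Q_def)
    next
      case False
      then have "(p, q, r) \<in> W'"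
        using W by (auto simp: W'_iff W_iff)
      then have "(p, q) \<in> P \<longleftrightarrow> (q, r) \<in> P"
        using closed_underD[OF P] new.closed_under_backward[OF P] by blast
      then show ?thesis
        using t b by (simp add: Q_def)
    qed
  qed
  \<comment> \<open>By the invariant, \<open>Q\<close> contains all edges of this class or
    none.\<close>
  from classes[OF this] have "(p, q) \<in> Q \<Longrightarrow> (p', q') \<in> Q"
    if "(p, q) \<in> Rstar W" "(p', q') \<in> Rstar W" "t q = t v" "t q' = t v" for p q p' q'
    using that by simp
  from this[OF x(1,2)] this[OF x(2,1)] have "(u, v) \<in> Q \<longleftrightarrow> (u', v') \<in> Q"
    using x(3) by argo
  then show ?thesis
    using x(3) by (simp add: Q_def) blast
qed

text \<open>Membership in \<open>P\<close> is constant around the cycle. At \<open>q \<in> J\<close>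
  this passes through an old class: from \<open>(prv q, q)\<close> to the old successor at
  \<open>q\<close>, by \<open>old_class\<close> to the edge \<open>(p, q)\<close> of
  \<open>Fset s\<close>, then to \<open>(q, nxt q)\<close>. Old edges with a label in
  \<open>M\<close> are attached through the same \<open>(p, q)\<close>.\<close>

lemma merged_class:
  assumes P: "closed_under W' P" and v: "(u, v) \<in> Rstar W'" "v \<in> set vs \<or> t v \<in> M"
    and w: "w \<in> set vs"
  shows "(u, v) \<in> P \<longleftrightarrow> (prv w, w) \<in> P"
proof -
  have W': "(p, q) \<in> P \<longleftrightarrow> (q, r) \<in> P" if "(p, q, r) \<in> W'" for p q r
    using that closed_underD[OF P] new.closed_under_backward[OF P] by blast
  have J: "((p, q) \<in> P \<longleftrightarrow> (q, nxt q) \<in> P) \<and> ((prv q, q) \<in> P \<longleftrightarrow> (q, nxt q) \<in> P)"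
    if "q \<in> J" "(p, q) \<in> Fset s" for p q
  proof -
    have "(p, q, nxt q) \<in> W'" "(prv q, q, the (jval s q)) \<in> W'"
      using that by (auto simp: W'_iff)
    moreover have "(p, q) \<in> P \<longleftrightarrow> (q, the (jval s q)) \<in> P"
      using old_class[OF P] F_edge that j_old tval_edge by metis
    ultimately show ?thesis
      using W' by blast
  qed
  have step: "(prv q, q) \<in> P \<longleftrightarrow> (prv (nxt q), nxt q) \<in> P" if "q \<in> set vs" for q
  proof (cases "q \<in> J")
    case True
    then show ?thesis
      using J J_F prv_nxt that by metis
  next
    case False
    then have "(prv q, q, nxt q) \<in> W'"
      using that by (auto simp: W'_iff)
    then show ?thesis
      using W' prv_nxt that by metis
  qed
  note cyc = nxt_invariant[of "\<lambda>q. (prv q, q) \<in> P", OF step]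
  show ?thesis
  proof (cases "(u, v) \<in> C")
    case True
    then have "u = prv v" "v \<in> set vs"
      by auto
    then show ?thesis
      using cyc[of v w] w by simp
  next
    case False
    then have old: "(u, v) \<in> Rstar W"
      using v by (auto simp: Rstar_W')
    then have "t v \<in> M"
      using v tval_edge by (auto simp: M_eq)
    then obtain q p where "q \<in> J" "t q = t v" "(p, q) \<in> Fset s"
      using J_ex J_F by blast
    then show ?thesis
      using old_class[OF P old F_edge] J J_sub cyc w by metis
  qed
qed

text \<open>The fresh label \<open>cnt s + 1\<close> exceeds all labels in use, and
  \<open>Min M\<close> was carried only by nodes that are relabelled anyway, so no node outside the
  merged part has label \<open>a\<close>.\<close>

lemma new_label:
  defines "a \<equiv> if M = {} then cnt s + 1 else Min M"
  shows "a \<noteq> 0" and "tval s' v = a \<longleftrightarrow> v \<in> set vs \<or> v \<in> V \<and> t v \<in> M"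
    and "a \<le> cnt s'"
proof -
  have "finite M"
    by (simp add: M_eq)
  then have M: "Min M \<in> M" if "M \<noteq> {}"
    using that by simp
  then show "a \<noteq> 0"
    by (auto simp: a_def M_eq)
  show "a \<le> cnt s'"
  proof (cases "M = {}")
    case False
    then obtain w where "Min M = t w"
      using M M_eq by blast
    then show ?thesis
      using tval_le[of w] False by (simp add: a_def fields)
  qed (simp add: a_def fields)
  show "tval s' v = a \<longleftrightarrow> v \<in> set vs \<or> v \<in> V \<and> t v \<in> M"
  proof (cases "M = {}")
    case True
    then show ?thesis
      using tval_le[of v] by (auto simp: a_def fields)
  next
    case False
    \<comment> \<open>Labelled nodes are targets of edges in \<open>Fset s\<close>, hence lie in
      \<open>V\<close>.\<close>
    have "v \<in> V" if "t v = Min M"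
    proof -
      have "t v \<noteq> 0"
        using M[OF False] that by (auto simp: M_eq)
      then show ?thesis
        using F_ex F_edge edges_in by blast
    qed
    then show ?thesis
      using M[OF False] False by (auto simp: a_def fields)
  qed
qed

lemma tval'_cases: "tval s' v = (if v \<in> set vs \<or> v \<in> V \<and> t v \<in> M then (if M = {} then cnt s + 1 else Min M) else t v)"
  by (simp add: fields)

lemma C_endpoints: "(u, v) \<in> C \<Longrightarrow> u \<in> set vs \<and> v \<in> set vs \<and> u \<noteq> v \<and> v = nxt u"
  using nxt_prv nxt_neq by force

text \<open>Two orientations of one edge on the cycle would force
  \<open>nxt (nxt w) = w\<close>.\<close>

lemma inj_C: "inj_on undirected C"
proof (rule inj_onI)
  fix x y assume "x \<in> C" "y \<in> C" "undirected x = undirected y"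
  then obtain w w' where "x = (prv w, w)" "y = (prv w', w')" "w \<in> set vs" "w' \<in> set vs"
      "{prv w, w} = {prv w', w'}"
    by (auto simp: undirected_def)
  then show "x = y"
    using nxt_prv nxt_nxt by (metis doubleton_eq_iff)
qed

lemma merged: "et_invariant V D s'"
proof (rule et_invariant.intro)
  show "finite V"
    by (rule finite_nodes)
  show "Rstar W' \<subseteq> V \<times> V"
    using edges_in C_endpoints cycle_nodes unfolding Rstar_W' by fast
  show "u \<noteq> v" if "(u, v) \<in> Rstar W'" for u v
    using that no_loop C_endpoints unfolding Rstar_W' by blast
  show "(u, v, x) \<notin> written s'" if "(u, v) \<in> Fset s'" for u v x
    using that F_unwritten C_unwritten J_sub F_tval unfolding fields by blast
  show "\<exists>u. (u, v) \<in> Fset s'" if "tval s' v \<noteq> 0" for v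
  proof (cases "t v = 0")
    \<comment> \<open>Since 0 is not in \<open>M\<close>, an unlabelled node gets a label only by
      lying on the cycle, and then its entering cycle edge joins \<open>Fset s'\<close>.\<close>
    case True
    then have "v \<in> set vs"
      using that by (auto simp: tval'_cases M_eq split: if_splits)
    with True show ?thesis
      by (auto simp: fields)
  qed (use F_ex in \<open>auto simp: fields\<close>)
  show "u = w" if "(u, v) \<in> Fset s'" "(w, v) \<in> Fset s'" for u v w
    using that by (auto simp: fields dest: F_unique F_tval)
  show "tval s' u = tval s' v \<and> tval s' v \<noteq> 0" if "(u, v) \<in> Rstar W'" for u v
  proof (cases "(u, v) \<in> C")
    case True
    then show ?thesis
      using C_endpoints[OF True] new_label(1) by (simp add: tval'_cases)
  next
    case False
    then have e: "(u, v) \<in> Rstar W"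
      using that unfolding Rstar_W' by blast
    have t: "t u = t v" "t v \<noteq> 0"
      using tval_edge[OF e] by auto
    have "u \<in> V" "v \<in> V"
      using e edges_in by auto
    moreover have "w \<in> set vs \<Longrightarrow> t w \<noteq> 0 \<Longrightarrow> t w \<in> M" for w
      by (auto simp: M_eq)
    ultimately have "u \<in> set vs \<or> u \<in> V \<and> t u \<in> M \<longleftrightarrow> t v \<in> M"
        "v \<in> set vs \<or> v \<in> V \<and> t v \<in> M \<longleftrightarrow> t v \<in> M"
      using t by metis+
    then show ?thesis
      using t new_label(1) unfolding tval'_cases by simp
  qed
  show "tval s' v \<le> cnt s'" for v
    using new_label(3) tval_le[of v] unfolding fields by (cases "M = {}") auto
  show "cnt s' \<le> card {v \<in> V. tval s' v \<noteq> 0}"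
  proof -
    let ?N = "{v \<in> V. t v \<noteq> 0}" and ?N' = "{v \<in> V. tval s' v \<noteq> 0}"
    have sub: "?N \<subseteq> ?N'"
      using new_label(1) unfolding tval'_cases by (cases "M = {}") auto
    have "finite ?N'"
      using finite_nodes by simp
    show ?thesis
    proof (cases "M = {}")
      \<comment> \<open>With \<open>M\<close> empty all cycle nodes were unlabelled, so any of them
        pays for the increased counter.\<close>
      case True
      obtain w where "w \<in> set vs"
        using length by (cases vs) auto
      then have "w \<in> ?N' - ?N"
        using True new_label(1) cycle_nodes unfolding tval'_cases by (auto simp: M_eq)
      with sub have "?N \<subset> ?N'"
        by blast
      then have "card ?N < card ?N'"
        by (rule psubset_card_mono[OF \<open>finite ?N'\<close>])
      then show ?thesis
        unfolding fields(1) using cnt_le True by simp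
    next
      case False
      then show ?thesis
        unfolding fields(1) using card_mono[OF \<open>finite ?N'\<close> sub] cnt_le False by simp
    qed
  qed
  show "successor_permutation W'"
    by (rule perm')
  show "(u', v') \<in> P" if P: "closed_under W' P" and x: "(u, v) \<in> P" "(u, v) \<in> Rstar W'"
      "(u', v') \<in> Rstar W'" "tval s' v = tval s' v'" for P u v u' v'
  \<comment> \<open>Equal new labels mean that both targets are in the merged part or neither is; in
    the latter case both edges are old and keep their labels.\<close>
  proof (cases "v \<in> set vs \<or> v \<in> V \<and> t v \<in> M")
    case True
    then have True': "v' \<in> set vs \<or> v' \<in> V \<and> t v' \<in> M"
      using x new_label(2) by metis
    obtain w where "w \<in> set vs"
      using length by (cases vs) auto
    then show ?thesis
      using merged_class[OF P] x True True' by metis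
  next
    case False
    then have False': "\<not> (v' \<in> set vs \<or> v' \<in> V \<and> t v' \<in> M)"
      using x new_label(2) by metis
    have "(u, v) \<in> Rstar W" "(u', v') \<in> Rstar W"
      using False False' x(2,3) C_endpoints unfolding Rstar_W' by blast+
    moreover have "t v = t v'"
      using x(4) False False' by (simp only: tval'_cases if_False)
    ultimately show ?thesis
      using old_class[OF P] x by blast
  qed
  have C_sub: "undirected ` C \<subseteq> Eint s"
    using cycle_edges by (simp only: undirected_C)
  show "inj_on undirected (Rstar W')"
    unfolding Rstar_W' inj_on_Un using orientation inj_C C_sub disjoint by blast
  show "undirected ` Rstar W' \<inter> Eint s' = {}"
    using disjoint unfolding Rstar_W' by (auto simp: fields)
  show "undirected ` Rstar W' \<union> Eint s' = D"
    using edges_read C_sub unfolding Rstar_W' fields by blast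
qed

end


section \<open>Runs\<close>

text \<open>As \<open>Eint s\<close> is acyclic, the cycle passes through \<open>e\<close>. Deleting
  it leaves a subset of \<open>Eint s\<close>, again acyclic.\<close>

lemma read_edge_invariant:
  assumes inv: "et_invariant V D s" and acyclic: "\<nexists>vs. is_cycle V (Eint s) vs"
    and e: "e \<notin> D" and step: "read_edge V e s s'"
  shows "et_invariant V (insert e D) s' \<and> (\<nexists>vs. is_cycle V (Eint s') vs)"
  using step
proof cases
  case no_cycle
  then show ?thesis
    using et_invariant.read[OF inv e] by simp
next
  case (cycle vs J)
  note cycle_case = cycle
  let ?s = "s\<lparr>Eint := insert e (Eint s)\<rparr>"
  interpret merge V "insert e D" ?s vs J
    using et_invariant.read[OF inv e] cycle_case(2,3)
    by (intro merge.intro cyclic_list.intro merge_axioms.intro) (auto simp: is_cycle_def)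
  have "\<exists>i \<in> {1..length vs}. {cyc vs i, cyc vs (i + 1)} = e"
  proof (rule ccontr)
    assume "\<not> ?thesis"
    then have "is_cycle V (Eint s) vs"
      using cycle_case(2) unfolding is_cycle_def by auto
    then show False
      using acyclic by blast
  qed
  then have "e \<in> {{cyc vs i, cyc vs (i + 1)} | i. i \<in> {1..length vs}}"
    by blast
  then have "e \<in> undirected ` C"
    unfolding pair_set_cyc(3) undirected_C .
  then have "Eint s' \<subseteq> Eint s"
    using cycle_case(1) fields(3) by auto
  then show ?thesis
    using merged cycle_case(1) acyclic is_cycle_mono by blast
qed

lemma read_stream_invariant:
  assumes "read_stream V es s s'" "et_invariant V D s" "\<nexists>vs. is_cycle V (Eint s) vs"
    and "distinct es" "set es \<inter> D = {}"
  shows "et_invariant V (set es \<union> D) s' \<and> (\<nexists>vs. is_cycle V (Eint s') vs)"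
  using assms
proof (induction arbitrary: D rule: read_stream.induct)
  case (Cons e s s' es s'')
  have "et_invariant V (insert e D) s' \<and> (\<nexists>vs. is_cycle V (Eint s') vs)"
    using Cons by (intro read_edge_invariant[of V D s e s']) auto
  then show ?case
    using Cons.IH[of "insert e D"] Cons.prems by auto
qed auto

section \<open>The state at the end of the stream\<close>

lemma constant_along_steps:
  assumes "\<And>x. x \<in> set (steps ws) \<Longrightarrow> f (fst x) = f (snd x)" and "v \<in> set ws"
  shows "f v = f (hd ws)"
  using assms
proof (induction ws rule: induct_list012)
  case (3 a b ws)
  then show ?case
    by (fastforce simp: steps_Cons_Cons)
qed (auto simp: steps_def)

lemma in_steps: "x \<in> set (steps ws) \<Longrightarrow> fst x \<in> set ws \<and> snd x \<in> set ws"
  by (cases x; cases ws) (auto simp: steps_def dest: set_zip_leftD set_zip_rightD)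

text \<open>Degrees in \<open>D\<close> are even by the Eulerian trail, and those of the oriented
  part because its successor map is a permutation. So \<open>Eint s\<close> has even degrees and, if
  nonempty, would contain a cycle.\<close>

lemma (in et_invariant) all_edges_written:
  assumes simple: "simple_graph V D" and euler: "eulerian V D" and "\<nexists>vs. is_cycle V (Eint s) vs"
  shows "Eint s = {}"
proof (rule ccontr)
  assume "Eint s \<noteq> {}"
  interpret successor_permutation "final_written s"
    by (rule perm)
  let ?U = "undirected ` Rstar (final_written s)"
  have "simple_graph V (Eint s)"
    using simple edges_read by (auto simp: simple_graph_def)
  moreover have "even (card {e \<in> Eint s. v \<in> e})" for v
  proof -
    have "finite D"
      using simple by (auto simp: simple_graph_def intro: finite_subset[of D "Pow V"])
    then have "card {e \<in> D. v \<in> e} = card {e \<in> ?U. v \<in> e} + card {e \<in> Eint s. v \<in> e}"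
      using edges_read disjoint by (subst card_Un_disjoint[symmetric]) (auto intro: arg_cong[where f = card])
    moreover have "even (card {e \<in> ?U. v \<in> e})"
      using finite_Rstar orientation no_loop balanced by (intro even_degree_balanced) auto
    ultimately show ?thesis
      using even_degree_eulerian[OF simple euler, of v] by simp
  qed
  ultimately show False
    using even_degrees_cycle \<open>Eint s \<noteq> {}\<close> assms(3) by blast
qed

theorem theorem2:
  fixes V :: "'a set" and E :: "'a set set" and es :: "'a set list"
    and W :: "('a \<times> 'a \<times> 'a) set" and errs :: "et_error set"
  assumes "simple_graph V E"
    and "eulerian V E"
    and "distinct es" and "set es = E"
    and "euler_tour_run V es W errs"
  shows "one_orientation_each E (Rstar W) \<and>
    well_defined_succ W \<and>
    (\<forall>e \<in> Rstar W.
       euler_tour V (Rstar W) (map (\<lambda>i. fst ((dstar W ^^ i) e)) [0..<card E + 1]) \<and>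
       distinct (map (\<lambda>i. (dstar W ^^ i) e) [0..<card E]) \<and>
       set (map (\<lambda>i. (dstar W ^^ i) e) [0..<card E]) = Rstar W \<and>
       (dstar W ^^ card E) e = e)"
proof -
  obtain s where run: "read_stream V es init_state s" and W: "W = final_written s"
    using assms(5) by (auto simp: euler_tour_run_def)
  have "finite V"
    using assms(1) by (simp add: simple_graph_def)
  moreover have "\<nexists>vs. is_cycle V (Eint (init_state :: 'a et_state)) vs"
    by (fastforce simp: init_state_def is_cycle_def)
  ultimately have inv: "et_invariant V E s" and acyclic: "\<nexists>vs. is_cycle V (Eint s) vs"
    using read_stream_invariant[OF run et_invariant_init] assms(3,4) by auto
  interpret et_invariant V E s
    by (rule inv)
  interpret successor_permutation W
    unfolding W by (rule perm)
  have edges: "undirected ` Rstar W = E"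
    using edges_read all_edges_written[OF assms(1,2) acyclic] W by simp
  have inj: "inj_on undirected (Rstar W)"
    using orientation W by simp
  have card: "card E = card (Rstar W)"
    using card_image[OF inj] edges by simp
  \<comment> \<open>Oriented edges join equally labelled nodes, so labels are constant along the
    Eulerian trail, which covers every edge.\<close>
  have "\<exists>m. \<forall>(u, v) \<in> Rstar W. tval s v = m"
  proof -
    obtain ws where ws: "set (map undirected (steps ws)) = E"
      using assms(2) by (auto simp: eulerian_def)
    have "tval s (fst x) = tval s (snd x)" if "x \<in> set (steps ws)" for x
    proof -
      have "undirected x \<in> undirected ` Rstar W"
        using imageI[OF that, of undirected] ws edges by simp
      then obtain y where "y \<in> Rstar W" "undirected x = undirected y"
        by blast
      \<comment> \<open>The trail may traverse the edge against its orientation \<open>y\<close>;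
        equality of labels is symmetric.\<close>
      then show ?thesis
        using tval_edge[of "fst y" "snd y"] W by (auto simp: undirected_def doubleton_eq_iff)
    qed
    note const = constant_along_steps[of ws "tval s", OF this]
    have "tval s v = tval s (hd ws)" if "(u, v) \<in> Rstar W" for u v
    proof -
      have "undirected (u, v) \<in> undirected ` set (steps ws)"
        using that ws edges by (metis image_eqI set_map)
      then obtain x where "x \<in> set (steps ws)" "{u, v} = undirected x"
        by (auto simp: undirected_def)
      then have "v = fst x \<or> v = snd x"
        by (auto simp: undirected_def doubleton_eq_iff)
      then show ?thesis
        using const in_steps[OF \<open>x \<in> set (steps ws)\<close>] by blast
    qed
    then show ?thesis
      by auto
  qed
  then obtain m where m: "(u, v) \<in> Rstar W \<Longrightarrow> tval s v = m" for u v
    by blast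
  \<comment> \<open>With one label on all edges, \<open>classes\<close> puts any two edges on the
    same orbit.\<close>
  have conn: "Rstar W \<subseteq> P" if P: "closed_under W P" "e \<in> P" "e \<in> Rstar W" for P e
  proof (rule subrelI)
    fix u v assume "(u, v) \<in> Rstar W"
    then show "(u, v) \<in> P"
      using classes[of P "fst e" "snd e" u v] P m[of "fst e" "snd e"] m[of u v] unfolding W by simp
  qed
  have "one_orientation_each E (Rstar W)"
    using inj edges unfolding one_orientation_each_def by (auto dest: inj_onD)
  moreover have "euler_tour V (Rstar W) (map (\<lambda>i. fst ((dstar W ^^ i) e)) [0..<card E + 1]) \<and>
       distinct (map (\<lambda>i. (dstar W ^^ i) e) [0..<card E]) \<and>
       set (map (\<lambda>i. (dstar W ^^ i) e) [0..<card E]) = Rstar W \<and>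
       (dstar W ^^ card E) e = e" if e: "e \<in> Rstar W" for e
  proof -
    define f where "f i = (dstar W ^^ i) e" for i
    note orbit = single_orbit[OF e conn[OF _ _ e], folded f_def card]
    have f_in: "f i \<in> Rstar W" for i
      using funpow_dstar_in[OF e] by (simp add: f_def)
    have "snd (f i) = fst (f (Suc i))" for i
      using dstar_triple(2)[OF f_in[of i]] by (simp add: f_def)
    \<comment> \<open>The \<open>card E + 1\<close> nodes give \<open>card E\<close> steps; the
      extra last node is where the tour closes.\<close>
    then have steps: "steps (map (\<lambda>i. fst (f i)) [0..<card E + 1]) = map f [0..<card E]"
      by (intro nth_equalityI) (auto simp: steps_def nth_tl prod_eq_iff simp del: upt_Suc)
    have dist: "distinct (map f [0..<card E])" "set (map f [0..<card E]) = Rstar W"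
      using orbit by (auto simp: distinct_map atLeast0LessThan)
    have "euler_tour V (Rstar W) (map (\<lambda>i. fst (f i)) [0..<card E + 1])"
      unfolding euler_tour_def steps
    proof (intro conjI dist)
      show "set (map (\<lambda>i. fst (f i)) [0..<card E + 1]) \<subseteq> V"
      proof -
        have "fst (f i) \<in> V" for i
          using f_in[of i] edges_in W by (cases "f i") auto
        then show ?thesis
          by auto
      qed
      show "hd (map (\<lambda>i. fst (f i)) [0..<card E + 1]) = last (map (\<lambda>i. fst (f i)) [0..<card E + 1])"
        using orbit(1) by (simp add: hd_map last_map hd_append f_def del: upt_Suc)
    qed simp
    then show ?thesis
      using dist orbit(1) unfolding f_def by blast
  qed
  ultimately show ?thesis
    using well_defined_succ by blast
qed

end
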